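(* Let $\mathcal S(Q,\omega)$ be a non-empty subword complex, and let $\mathcal L(Q,\omega)=\bigcup_I\mathcal L(I)$, the union over all facets $I$ of $\mathcal S(Q,\omega)$. Then: (1) for every facet $I$, the set $\mathcal L(I)$ is order convex in the weak order; (2) $\mathcal L(Q,\omega)$ is a lower set of the weak order; (3) $[e,\omega]\subseteq\mathcal L(Q,\omega)$; (4) if $I_1\neq I_2$ are facets, then $\mathcal L(I_1)\cap\mathcal L(I_2)=\varnothing$.
   Context: Let $\Phi$ be a finite root system with positive roots $\Phi^+$, negative roots $\Phi^-$, simple roots $\Delta$, finite Coxeter group $W$ generated by simple reflections $S$; $\alpha_s$ is the simple root of $s\in S$. The inversion set of $\omega\in W$ is $\mathrm{Inv}(\omega)=\Phi^+\cap\omega(\Phi^-)$. The weak order on $W$: $\sigma\le\omega$ iff $\mathrm{Inv}(\sigma)\subseteq\mathrm{Inv}(\omega)$; $[e,\omega]=\{\sigma:\sigma\le\omega\}$. A subset $\mathfrak R\subseteq W$ is a lower set if $\sigma<\tau\in\mathfrak R$ implies $\sigma\in\mathfrak R$, and order convex if $\sigma<\tau<\rho$ with $\sigma,\rho\in\mathfrak R$ implies $\tau\in\mathfrak R$. Let $Q=(q_1,\dots,q_m)$ be a word on $S$ and $\omega\in W$; $Q_J$ is the subword at positions $J\subseteq[m]$. The subword complex $\mathcal S(Q,\omega)$ has facets the $I\subseteq[m]$ with $Q_{[m]\setminus I}$ a reduced expression of $\omega$. Root function: $r(I,k)=\prod Q_{[k-1]\setminus I}(\alpha_{q_k})$ (product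 in order of the letters at positions in $[k-1]\setminus I$, applied to $\alpha_{q_k}$). Root configuration $R(I)=\{r(I,i):i\in I\}$. Linear extensions of a facet: $\mathcal L(I)=\{\pi\in W:R(I)\subseteq\pi(\Phi^+)\}$. *)

theory Defs
  imports
    "HOL-Analysis.Analysis"
    "HOL-Algebra.Bij"
    "HOL-Algebra.Generated_Groups"
begin

section \<open>Finite root systems and their Coxeter groups\<close>

definition reflection :: "'a::euclidean_space \<Rightarrow> 'a \<Rightarrow> 'a" where
  "reflection \<alpha> v = v - (2 * (v \<bullet> \<alpha>) / (\<alpha> \<bullet> \<alpha>)) *\<^sub>R \<alpha>"

text \<open>
  Root systems are reduced, but neither crystallographic nor spanning: every finite Coxeter
  group is covered, and the action on the ambient space need not be essential.
\<close>

definition root_system :: "'a::euclidean_space set \<Rightarrow> bool" where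
  "root_system \<Phi> \<longleftrightarrow>
     finite \<Phi> \<and> 0 \<notin> \<Phi> \<and>
     (\<forall>\<alpha>\<in>\<Phi>. \<Phi> \<inter> span {\<alpha>} = {\<alpha>, - \<alpha>}) \<and>
     (\<forall>\<alpha>\<in>\<Phi>. reflection \<alpha> ` \<Phi> = \<Phi>)"

definition positive_roots :: "'a::euclidean_space set \<Rightarrow> 'a set \<Rightarrow> 'a set" where
  "positive_roots \<Phi> \<Delta> =
     {\<beta> \<in> \<Phi>. \<exists>c. (\<forall>\<delta>\<in>\<Delta>. 0 \<le> c \<delta>) \<and> \<beta> = (\<Sum>\<delta>\<in>\<Delta>. c \<delta> *\<^sub>R \<delta>)}"

definition negative_roots :: "'a::euclidean_space set \<Rightarrow> 'a set \<Rightarrow> 'a set" where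
  "negative_roots \<Phi> \<Delta> = uminus ` positive_roots \<Phi> \<Delta>"

definition simple_system :: "'a::euclidean_space set \<Rightarrow> 'a set \<Rightarrow> bool" where
  "simple_system \<Phi> \<Delta> \<longleftrightarrow>
     \<Delta> \<subseteq> \<Phi> \<and> independent \<Delta> \<and> \<Phi> = positive_roots \<Phi> \<Delta> \<union> negative_roots \<Phi> \<Delta>"

definition simple_reflections :: "'a::euclidean_space set \<Rightarrow> ('a \<Rightarrow> 'a) set" where
  "simple_reflections \<Delta> = reflection ` \<Delta>"

text \<open>\<open>simple_root \<Delta> s\<close> is $\alpha_s$; it is meaningful for \<open>s \<in> simple_reflections \<Delta>\<close> only,
  where it is well defined because distinct simple roots have distinct reflections.\<close>

definition simple_root :: "'a::euclidean_space set \<Rightarrow> ('a \<Rightarrow> 'a) \<Rightarrow> 'a" where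
  "simple_root \<Delta> s = (THE \<alpha>. \<alpha> \<in> \<Delta> \<and> reflection \<alpha> = s)"

text \<open>\<open>BijGroup UNIV\<close> is the group of all bijections of the ambient space under composition,
  so elements of $W$ are actual functions and act on roots by application.\<close>

definition coxeter_group :: "'a::euclidean_space set \<Rightarrow> ('a \<Rightarrow> 'a) set" where
  "coxeter_group \<Delta> = generate (BijGroup UNIV) (simple_reflections \<Delta>)"


section \<open>The weak order\<close>

definition inversions ::
  "'a::euclidean_space set \<Rightarrow> 'a set \<Rightarrow> ('a \<Rightarrow> 'a) \<Rightarrow> 'a set" where
  "inversions \<Phi> \<Delta> w = positive_roots \<Phi> \<Delta> \<inter> w ` negative_roots \<Phi> \<Delta>"

definition weak_le ::
  "'a::euclidean_space set \<Rightarrow> 'a set \<Rightarrow> ('a \<Rightarrow> 'a) \<Rightarrow> ('a \<Rightarrow> 'a) \<Rightarrow> bool" where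
  "weak_le \<Phi> \<Delta> \<sigma> \<tau> \<longleftrightarrow> inversions \<Phi> \<Delta> \<sigma> \<subseteq> inversions \<Phi> \<Delta> \<tau>"

definition weak_less ::
  "'a::euclidean_space set \<Rightarrow> 'a set \<Rightarrow> ('a \<Rightarrow> 'a) \<Rightarrow> ('a \<Rightarrow> 'a) \<Rightarrow> bool" where
  "weak_less \<Phi> \<Delta> \<sigma> \<tau> \<longleftrightarrow> weak_le \<Phi> \<Delta> \<sigma> \<tau> \<and> \<sigma> \<noteq> \<tau>"

definition weak_interval_from_id ::
  "'a::euclidean_space set \<Rightarrow> 'a set \<Rightarrow> ('a \<Rightarrow> 'a) \<Rightarrow> ('a \<Rightarrow> 'a) set" where
  "weak_interval_from_id \<Phi> \<Delta> \<tau> = {\<sigma> \<in> coxeter_group \<Delta>. weak_le \<Phi> \<Delta> \<sigma> \<tau>}"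

definition lower_set ::
  "'a::euclidean_space set \<Rightarrow> 'a set \<Rightarrow> ('a \<Rightarrow> 'a) set \<Rightarrow> bool" where
  "lower_set \<Phi> \<Delta> R \<longleftrightarrow>
     R \<subseteq> coxeter_group \<Delta> \<and>
     (\<forall>\<sigma>\<in>coxeter_group \<Delta>. \<forall>\<tau>\<in>R. weak_less \<Phi> \<Delta> \<sigma> \<tau> \<longrightarrow> \<sigma> \<in> R)"

definition order_convex ::
  "'a::euclidean_space set \<Rightarrow> 'a set \<Rightarrow> ('a \<Rightarrow> 'a) set \<Rightarrow> bool" where
  "order_convex \<Phi> \<Delta> R \<longleftrightarrow>
     R \<subseteq> coxeter_group \<Delta> \<and>
     (\<forall>\<sigma>\<in>R. \<forall>\<rho>\<in>R. \<forall>\<tau>\<in>coxeter_group \<Delta>.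
        weak_less \<Phi> \<Delta> \<sigma> \<tau> \<and> weak_less \<Phi> \<Delta> \<tau> \<rho> \<longrightarrow> \<tau> \<in> R)"


section \<open>Words and subword complexes\<close>

definition word_prod :: "('a \<Rightarrow> 'a) list \<Rightarrow> 'a \<Rightarrow> 'a" where
  "word_prod ws = foldr (\<circ>) ws id"

definition coxeter_length :: "'a::euclidean_space set \<Rightarrow> ('a \<Rightarrow> 'a) \<Rightarrow> nat" where
  "coxeter_length \<Delta> w =
     (LEAST n. \<exists>ws. set ws \<subseteq> simple_reflections \<Delta> \<and> word_prod ws = w \<and> length ws = n)"

definition reduced_expression ::
  "'a::euclidean_space set \<Rightarrow> ('a \<Rightarrow> 'a) list \<Rightarrow> ('a \<Rightarrow> 'a) \<Rightarrow> bool" where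
  "reduced_expression \<Delta> ws w \<longleftrightarrow>
     set ws \<subseteq> simple_reflections \<Delta> \<and> word_prod ws = w \<and> length ws = coxeter_length \<Delta> w"

text \<open>Positions in a word are counted from 0, so $[m]$ becomes \<open>{..<length Q}\<close>, $[k-1]$ becomes
  \<open>{..<k}\<close>, and the subword $Q_J$ is \<open>nths Q J\<close>.\<close>

definition facets ::
  "'a::euclidean_space set \<Rightarrow> ('a \<Rightarrow> 'a) list \<Rightarrow> ('a \<Rightarrow> 'a) \<Rightarrow> nat set set" where
  "facets \<Delta> Q w =
     {I. I \<subseteq> {..<length Q} \<and> reduced_expression \<Delta> (nths Q ({..<length Q} - I)) w}"

definition subword_complex ::
  "'a::euclidean_space set \<Rightarrow> ('a \<Rightarrow> 'a) list \<Rightarrow> ('a \<Rightarrow> 'a) \<Rightarrow> nat set set" where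
  "subword_complex \<Delta> Q w = {F. \<exists>I\<in>facets \<Delta> Q w. F \<subseteq> I}"

definition root_function ::
  "'a::euclidean_space set \<Rightarrow> ('a \<Rightarrow> 'a) list \<Rightarrow> nat set \<Rightarrow> nat \<Rightarrow> 'a" where
  "root_function \<Delta> Q I k = word_prod (nths Q ({..<k} - I)) (simple_root \<Delta> (Q ! k))"

definition root_configuration ::
  "'a::euclidean_space set \<Rightarrow> ('a \<Rightarrow> 'a) list \<Rightarrow> nat set \<Rightarrow> 'a set" where
  "root_configuration \<Delta> Q I = root_function \<Delta> Q I ` I"

definition linear_extensions ::
  "'a::euclidean_space set \<Rightarrow> 'a set \<Rightarrow> ('a \<Rightarrow> 'a) list \<Rightarrow> nat set \<Rightarrow> ('a \<Rightarrow> 'a) set" where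
  "linear_extensions \<Phi> \<Delta> Q I =
     {\<pi> \<in> coxeter_group \<Delta>. root_configuration \<Delta> Q I \<subseteq> \<pi> ` positive_roots \<Phi> \<Delta>}"

definition all_linear_extensions ::
  "'a::euclidean_space set \<Rightarrow> 'a set \<Rightarrow> ('a \<Rightarrow> 'a) list \<Rightarrow> ('a \<Rightarrow> 'a) \<Rightarrow> ('a \<Rightarrow> 'a) set" where
  "all_linear_extensions \<Phi> \<Delta> Q w = (\<Union>I\<in>facets \<Delta> Q w. linear_extensions \<Phi> \<Delta> Q I)"

end

theory Submission
  imports Defs
begin

text \<open>
  Flipping a facet at two positions whose roots agree up to sign reflects the roots strictly
  between them and at the second one, and leaves the others alone. Let \<open>\<pi>\<close> be a linear extension
  of \<open>I\<close> that makes the simple root \<open>\<alpha>\<close> negative, and put \<open>\<delta> = - \<pi> \<alpha>\<close>. If $-\delta$ is in the root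
  configuration of \<open>I\<close>, then flipping the first against the last position carrying the root
  $\pm\delta$ gives a facet with linear extension $\pi s_\alpha$; otherwise $\pi s_\alpha$ is
  already a linear extension of \<open>I\<close>. Hence linear extensions form a lower set. The flip
  preserves the set of positions carrying $\pm\delta$, so it can be undone, and uniqueness of the
  facet at \<open>\<pi>\<close> follows by descent to the case where every root of the configuration is positive;
  there two facets cannot differ, as one sees at their last difference. A facet with the largest
  possible sum of positions has \<open>\<omega>\<close> as a linear extension, since any root of its configuration
  that is an inversion of \<open>\<omega>\<close> could be flipped to the right.
\<close>

section \<open>Reflections of a Euclidean space and products of words\<close>

lemma reflection_uminus_root: "reflection (- a) = reflection a"
  by (simp add: reflection_def fun_eq_iff)

lemma orthogonal_transformation_reflection_conj:
  assumes "orthogonal_transformation w"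
  shows "w (reflection a x) = reflection (w a) (w x)"
  using assms
  by (simp add: reflection_def orthogonal_transformation_def linear_diff linear_scale)

lemma reflection_uminus: "reflection a (- x) = - reflection a x"
  unfolding reflection_def by (simp add: inner_minus_left)

lemma reflection_self: "a \<noteq> 0 \<Longrightarrow> reflection a a = - a"
  by (simp add: reflection_def scaleR_2)

lemma reflection_involution: "reflection a (reflection a x) = x"
  by (cases "a = 0") (simp_all add: reflection_def inner_diff_left algebra_simps)

lemma reflection_comp_self: "reflection a \<circ> reflection a = id"
  by (simp add: fun_eq_iff reflection_involution)

lemma reflection_comp_comp: "reflection a \<circ> (reflection a \<circ> f) = f"
  by (simp add: fun_eq_iff reflection_involution)

lemma orthogonal_transformation_reflection: "orthogonal_transformation (reflection a)"
proof -
  have "linear (reflection a)"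
  proof (rule linearI)
    show "reflection a (x + y) = reflection a x + reflection a y" for x y
      by (simp add: reflection_def inner_add_left distrib_left add_divide_distrib scaleR_add_left)
    show "reflection a (c *\<^sub>R x) = c *\<^sub>R reflection a x" for c x
      by (simp add: reflection_def scaleR_right_diff_distrib mult.left_commute)
  qed
  moreover have "reflection a v \<bullet> reflection a w = v \<bullet> w" for v w
  proof (cases "a = 0")
    case False
    then have "a \<bullet> a \<noteq> 0" by simp
    then show ?thesis
      by (simp add: reflection_def inner_diff_left inner_diff_right inner_commute[of a w])
  qed (simp add: reflection_def)
  ultimately show ?thesis by (simp add: orthogonal_transformation_def)
qed

lemma word_prod_append: "word_prod (xs @ ys) = word_prod xs \<circ> word_prod ys"
proof -
  have "foldr (\<circ>) xs g = foldr (\<circ>) xs id \<circ> g" for g :: "'a \<Rightarrow> 'a"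
    by (induction xs) (simp_all add: comp_assoc)
  then show ?thesis unfolding word_prod_def foldr_append .
qed

section \<open>Prefix products of a word\<close>

text \<open>Symmetric difference with a singleton. Inserting and deleting a letter become one
  operation, so flips in both directions share a proof.\<close>

definition toggle :: "'b \<Rightarrow> 'b set \<Rightarrow> 'b set" where
  "toggle a I = (if a \<in> I then I - {a} else insert a I)"

lemma mem_toggle: "x \<in> toggle a I \<longleftrightarrow> (if x = a then a \<notin> I else x \<in> I)"
  by (auto simp: toggle_def)

text \<open>The product inside the root function, isolated because it satisfies a recursion in
  \<open>k\<close>; taken at \<open>k = length Q\<close> it is the product compared with
  \<omega>.\<close>

definition prefix_prod :: "('a \<Rightarrow> 'a) list \<Rightarrow> nat set \<Rightarrow> nat \<Rightarrow> 'a \<Rightarrow> 'a" where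
  "prefix_prod Q I k = word_prod (nths Q ({..<k} - I))"

lemma prefix_prod_0: "prefix_prod Q I 0 = id"
  by (simp add: prefix_prod_def word_prod_def)

lemma nths_Suc_prefix:
  "k < length Q \<Longrightarrow>
     nths Q ({..<Suc k} - I) = nths Q ({..<k} - I) @ (if k \<in> I then [] else [Q ! k])"
proof (induction Q arbitrary: k I)
  case (Cons x Q)
  show ?case
  proof (cases k)
    case 0
    then show ?thesis by (auto simp: nths_Cons)
  next
    case (Suc k')
    have e: "{j. Suc j \<in> {..<Suc n} - I} = {..<n} - {j. Suc j \<in> I}" for n by auto
    show ?thesis
      unfolding Suc nths_Cons e using Cons.IH[of k' "{j. Suc j \<in> I}"] Cons.prems Suc
      by (cases "Suc k' \<in> I") simp_all
  qed
qed simp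

lemma prefix_prod_Suc:
  "k < length Q \<Longrightarrow>
     prefix_prod Q I (Suc k) = (if k \<in> I then prefix_prod Q I k else prefix_prod Q I k \<circ> Q ! k)"
  by (simp add: prefix_prod_def nths_Suc_prefix word_prod_append) (simp add: word_prod_def)

lemma prefix_prod_full: "prefix_prod Q {} (length Q) = word_prod Q"
  by (simp add: prefix_prod_def nths_all)

lemma length_nths_lessThan: "length (nths Q ({..<length Q} - I)) = card ({..<length Q} - I)"
  by (auto simp: length_nths intro!: arg_cong[of _ _ card])

section \<open>Roots and inversions\<close>

lemma positive_rootsI:
  assumes "\<beta> \<in> \<Phi>" "\<And>\<delta>. \<delta> \<in> \<Delta> \<Longrightarrow> 0 \<le> c \<delta>" "\<beta> = (\<Sum>\<delta>\<in>\<Delta>. c \<delta> *\<^sub>R \<delta>)"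
  shows "\<beta> \<in> positive_roots \<Phi> \<Delta>"
  unfolding positive_roots_def mem_Collect_eq
  by (intro conjI exI[of _ c] ballI) (fact assms)+

lemma sum_scaleR_delta:
  fixes a :: "'b::real_vector"
  assumes "finite A" "a \<in> A"
  shows "(\<Sum>x\<in>A. (if x = a then u else 0) *\<^sub>R x) = u *\<^sub>R a"
proof -
  have "(\<Sum>x\<in>A. (if x = a then u else 0) *\<^sub>R x) = (\<Sum>x\<in>A. if x = a then u *\<^sub>R a else 0)"
    by (rule sum.cong) auto
  then show ?thesis using assms by simp
qed

locale simple_roots =
  fixes \<Phi> \<Delta> :: "'a::euclidean_space set"
  assumes root_system: "root_system \<Phi>"
    and simple_system: "simple_system \<Phi> \<Delta>"
begin

abbreviation Pos where "Pos \<equiv> positive_roots \<Phi> \<Delta>"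
abbreviation Neg where "Neg \<equiv> negative_roots \<Phi> \<Delta>"
abbreviation Inv where "Inv \<equiv> inversions \<Phi> \<Delta>"

lemma finite_roots: "finite \<Phi>" and zero_not_root: "0 \<notin> \<Phi>"
  and span_root: "\<alpha> \<in> \<Phi> \<Longrightarrow> \<Phi> \<inter> span {\<alpha>} = {\<alpha>, - \<alpha>}"
  and reflection_roots: "\<alpha> \<in> \<Phi> \<Longrightarrow> reflection \<alpha> ` \<Phi> = \<Phi>"
  using root_system by (auto simp: root_system_def)

lemma simple_subset: "\<Delta> \<subseteq> \<Phi>" and independent_simple: "independent \<Delta>"
  using simple_system by (simp_all add: simple_system_def)

lemma root_iff: "\<beta> \<in> \<Phi> \<longleftrightarrow> \<beta> \<in> Pos \<or> \<beta> \<in> Neg"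
  using simple_system unfolding simple_system_def by blast

lemma finite_simple: "finite \<Delta>"
  using finite_roots simple_subset finite_subset by blast

lemma simple_combination_zero:
  "(\<Sum>\<delta>\<in>\<Delta>. c \<delta> *\<^sub>R \<delta>) = 0 \<Longrightarrow> \<delta> \<in> \<Delta> \<Longrightarrow> c \<delta> = 0"
  using independentD[OF independent_simple finite_simple subset_refl, of c \<delta>] by simp

lemma pos_subset: "Pos \<subseteq> \<Phi>"
  using root_iff by blast

lemma finite_pos: "finite Pos"
  using finite_roots pos_subset finite_subset by blast

lemma uminus_mem_neg: "- \<beta> \<in> Neg \<longleftrightarrow> \<beta> \<in> Pos" and uminus_mem_pos: "- \<beta> \<in> Pos \<longleftrightarrow> \<beta> \<in> Neg"
  by (force simp: negative_roots_def)+

text \<open>Adding nonnegative expansions of \<beta> and - \<beta> gives a vanishing combination of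
  independent simple roots, so all coefficients are zero and \<beta> = 0.\<close>

lemma pos_inter_neg: "Pos \<inter> Neg = {}"
proof -
  have False if b: "\<beta> \<in> Pos" "- \<beta> \<in> Pos" for \<beta>
  proof -
    obtain c where c: "\<forall>\<delta>\<in>\<Delta>. 0 \<le> c \<delta>" "\<beta> = (\<Sum>\<delta>\<in>\<Delta>. c \<delta> *\<^sub>R \<delta>)"
      using b(1) by (auto simp: positive_roots_def)
    obtain d where d: "\<forall>\<delta>\<in>\<Delta>. 0 \<le> d \<delta>" "- \<beta> = (\<Sum>\<delta>\<in>\<Delta>. d \<delta> *\<^sub>R \<delta>)"
      using b(2) by (auto simp: positive_roots_def)
    have "(\<Sum>\<delta>\<in>\<Delta>. (c \<delta> + d \<delta>) *\<^sub>R \<delta>) = \<beta> + - \<beta>"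
      unfolding d(2) by (simp add: c(2) scaleR_left_distrib sum.distrib)
    then have "c \<delta> + d \<delta> = 0" if "\<delta> \<in> \<Delta>" for \<delta>
      using simple_combination_zero[of "\<lambda>\<delta>. c \<delta> + d \<delta>"] that by simp
    then have "c \<delta> = 0" if "\<delta> \<in> \<Delta>" for \<delta>
      using that c(1) d(1) by (metis add_nonneg_eq_0_iff)
    then have "\<beta> = 0" using c(2) by simp
    then show False using b(1) pos_subset zero_not_root by auto
  qed
  then show ?thesis using uminus_mem_pos by blast
qed

lemma simple_pos: "\<alpha> \<in> \<Delta> \<Longrightarrow> \<alpha> \<in> Pos"
  using simple_subset
  by (intro positive_rootsI[where c = "\<lambda>\<delta>. if \<delta> = \<alpha> then 1 else 0"])
    (auto simp: sum_scaleR_delta[OF finite_simple])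

text \<open>The reflection changes only the coefficient of \<alpha>. If the image were negative, all
  other coefficients of \<beta> would vanish, and since the root system is reduced, \<beta> would be
  \<alpha> or - \<alpha>.\<close>

lemma simple_reflection_pos:
  assumes a: "\<alpha> \<in> \<Delta>" and b: "\<beta> \<in> Pos" and ne: "\<beta> \<noteq> \<alpha>"
  shows "reflection \<alpha> \<beta> \<in> Pos"
proof (rule ccontr)
  assume "reflection \<alpha> \<beta> \<notin> Pos"
  moreover have "reflection \<alpha> \<beta> \<in> \<Phi>"
    using reflection_roots[of \<alpha>] a b simple_subset pos_subset by blast
  ultimately have "reflection \<alpha> \<beta> \<in> Neg" using root_iff by blast
  then have "- reflection \<alpha> \<beta> \<in> Pos" by (simp add: uminus_mem_pos)
  then obtain d where d: "\<forall>\<delta>\<in>\<Delta>. 0 \<le> d \<delta>" "- reflection \<alpha> \<beta> = (\<Sum>\<delta>\<in>\<Delta>. d \<delta> *\<^sub>R \<delta>)"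
    by (auto simp: positive_roots_def)
  obtain c where c: "\<forall>\<delta>\<in>\<Delta>. 0 \<le> c \<delta>" "\<beta> = (\<Sum>\<delta>\<in>\<Delta>. c \<delta> *\<^sub>R \<delta>)"
    using b by (auto simp: positive_roots_def)
  define t where "t = 2 * (\<beta> \<bullet> \<alpha>) / (\<alpha> \<bullet> \<alpha>)"
  have single: "(\<Sum>\<delta>\<in>\<Delta>. (if \<delta> = \<alpha> then u else 0) *\<^sub>R \<delta>) = u *\<^sub>R \<alpha>" for u
    using finite_simple a by (rule sum_scaleR_delta)
  have "\<beta> + - reflection \<alpha> \<beta> - t *\<^sub>R \<alpha> = 0"
    by (simp add: reflection_def t_def)
  then have "(\<Sum>\<delta>\<in>\<Delta>. (c \<delta> + d \<delta> - (if \<delta> = \<alpha> then t else 0)) *\<^sub>R \<delta>) = 0"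
    unfolding d(2) scaleR_diff_left scaleR_left_distrib sum_subtractf sum.distrib single
    by (simp flip: c(2))
  then have "c \<delta> + d \<delta> - (if \<delta> = \<alpha> then t else 0) = 0" if "\<delta> \<in> \<Delta>" for \<delta>
    using simple_combination_zero[of "\<lambda>\<delta>. c \<delta> + d \<delta> - (if \<delta> = \<alpha> then t else 0)"] that by simp
  then have "c \<delta> + d \<delta> = 0" if "\<delta> \<in> \<Delta>" "\<delta> \<noteq> \<alpha>" for \<delta>
    using that by fastforce
  then have z: "c \<delta> = 0" if "\<delta> \<in> \<Delta>" "\<delta> \<noteq> \<alpha>" for \<delta>
    using that c(1) d(1) by (metis add_nonneg_eq_0_iff)
  have "\<beta> = (\<Sum>\<delta>\<in>\<Delta>. (if \<delta> = \<alpha> then c \<alpha> else 0) *\<^sub>R \<delta>)"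
    unfolding c(2) by (rule sum.cong) (auto simp: z)
  then have "\<beta> = c \<alpha> *\<^sub>R \<alpha>" using single by simp
  then have "\<beta> \<in> \<Phi> \<inter> span {\<alpha>}" using b pos_subset
    by (auto intro: span_mul span_base)
  then have "\<beta> = - \<alpha>" using span_root a simple_subset ne by blast
  then have "\<alpha> \<in> Neg" using b uminus_mem_pos by simp
  then show False using simple_pos[OF a] pos_inter_neg by auto
qed

text \<open>Substituting the expansions of the \<open>u \<delta>\<close> into that of \<beta> keeps
  coefficients nonnegative. This settles the end of both descents below, where no simple root has
  the wrong sign.\<close>

lemma linear_image_pos:
  assumes u: "linear u" and simple: "\<And>\<alpha>. \<alpha> \<in> \<Delta> \<Longrightarrow> u \<alpha> \<in> Pos" and b: "\<beta> \<in> Pos" "u \<beta> \<in> \<Phi>"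
  shows "u \<beta> \<in> Pos"
proof -
  obtain c where c: "\<forall>\<delta>\<in>\<Delta>. 0 \<le> c \<delta>" "\<beta> = (\<Sum>\<delta>\<in>\<Delta>. c \<delta> *\<^sub>R \<delta>)"
    using b by (auto simp: positive_roots_def)
  have "\<exists>d. (\<forall>\<epsilon>\<in>\<Delta>. 0 \<le> d \<epsilon>) \<and> u \<delta> = (\<Sum>\<epsilon>\<in>\<Delta>. d \<epsilon> *\<^sub>R \<epsilon>)" if "\<delta> \<in> \<Delta>" for \<delta>
    using simple[OF that] by (auto simp: positive_roots_def)
  then obtain d where d: "\<And>\<delta>. \<delta> \<in> \<Delta> \<Longrightarrow>
      (\<forall>\<epsilon>\<in>\<Delta>. 0 \<le> d \<delta> \<epsilon>) \<and> u \<delta> = (\<Sum>\<epsilon>\<in>\<Delta>. d \<delta> \<epsilon> *\<^sub>R \<epsilon>)"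
    by metis
  have "u \<beta> = (\<Sum>\<delta>\<in>\<Delta>. c \<delta> *\<^sub>R u \<delta>)"
    unfolding c(2) using u by (simp add: linear_sum linear_scale)
  also have "\<dots> = (\<Sum>\<delta>\<in>\<Delta>. \<Sum>\<epsilon>\<in>\<Delta>. (c \<delta> * d \<delta> \<epsilon>) *\<^sub>R \<epsilon>)"
    by (rule sum.cong) (use d in \<open>simp_all add: scaleR_sum_right\<close>)
  also have "\<dots> = (\<Sum>\<epsilon>\<in>\<Delta>. (\<Sum>\<delta>\<in>\<Delta>. c \<delta> * d \<delta> \<epsilon>) *\<^sub>R \<epsilon>)"
    by (subst sum.swap) (simp add: scaleR_sum_left)
  finally have "u \<beta> = (\<Sum>\<epsilon>\<in>\<Delta>. (\<Sum>\<delta>\<in>\<Delta>. c \<delta> * d \<delta> \<epsilon>) *\<^sub>R \<epsilon>)" .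
  moreover have "0 \<le> (\<Sum>\<delta>\<in>\<Delta>. c \<delta> * d \<delta> \<epsilon>)" if "\<epsilon> \<in> \<Delta>" for \<epsilon>
    using c(1) d that by (intro sum_nonneg mult_nonneg_nonneg) blast+
  ultimately show ?thesis using b(2) by (intro positive_rootsI)
qed

lemma simple_reflection_neg:
  assumes "\<alpha> \<in> \<Delta>" "\<beta> \<in> Neg" "\<beta> \<noteq> - \<alpha>"
  shows "reflection \<alpha> \<beta> \<in> Neg"
proof -
  have "- \<beta> \<in> Pos" using assms(2) unfolding uminus_mem_pos .
  moreover have "- \<beta> \<noteq> \<alpha>" using assms(3) by auto
  ultimately have "reflection \<alpha> (- \<beta>) \<in> Pos"
    by (rule simple_reflection_pos[OF assms(1)])
  moreover have "reflection \<alpha> (- \<beta>) = - reflection \<alpha> \<beta>"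
    by (rule reflection_uminus)
  ultimately have "- reflection \<alpha> \<beta> \<in> Pos" by (simp only:)
  then show ?thesis unfolding uminus_mem_pos .
qed

lemma simple_reflection_self: "\<alpha> \<in> \<Delta> \<Longrightarrow> reflection \<alpha> \<alpha> = - \<alpha>"
  by (rule reflection_self) (use simple_subset zero_not_root in auto)

text \<open>The reflection in \<open>a\<close> negates \<open>a\<close>, whereas the reflection in
  any other simple root keeps \<open>a\<close> positive.\<close>

lemma inj_on_reflection_simple: "inj_on reflection \<Delta>"
proof (rule inj_onI)
  fix a b assume a: "a \<in> \<Delta>" and b: "b \<in> \<Delta>" and e: "reflection a = reflection b"
  show "a = b"
  proof (rule ccontr)
    assume "a \<noteq> b"
    then have "reflection b a \<in> Pos" using simple_reflection_pos simple_pos a b by blast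
    then have "- a \<in> Pos" using simple_reflection_self[OF a] e by simp
    then show False using simple_pos[OF a] uminus_mem_pos pos_inter_neg by blast
  qed
qed

lemma simple_root_reflection: "\<alpha> \<in> \<Delta> \<Longrightarrow> simple_root \<Delta> (reflection \<alpha>) = \<alpha>"
  unfolding simple_root_def using inj_on_reflection_simple by (auto dest: inj_onD)

lemma simple_root:
  assumes "s \<in> simple_reflections \<Delta>"
  shows "simple_root \<Delta> s \<in> \<Delta>" "reflection (simple_root \<Delta> s) = s"
  using assms by (auto simp: simple_reflections_def simple_root_reflection)

text \<open>What the sign arguments need from a group element. It passes directly to prefix products
  and inverses, without returning to the generated group.\<close>

definition root_automorphism :: "('a \<Rightarrow> 'a) \<Rightarrow> bool" where
  "root_automorphism w \<longleftrightarrow> orthogonal_transformation w \<and> w ` \<Phi> = \<Phi>"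

lemma root_automorphism_id: "root_automorphism id"
  by (simp add: root_automorphism_def orthogonal_transformation_def linear_id)

lemma root_automorphism_comp:
  "root_automorphism v \<Longrightarrow> root_automorphism w \<Longrightarrow> root_automorphism (v \<circ> w)"
  by (metis image_comp orthogonal_transformation_compose root_automorphism_def)

lemma root_automorphism_reflection: "\<alpha> \<in> \<Phi> \<Longrightarrow> root_automorphism (reflection \<alpha>)"
  by (simp add: root_automorphism_def orthogonal_transformation_reflection reflection_roots)

lemma root_automorphism_bij: "root_automorphism w \<Longrightarrow> bij w"
  by (simp add: root_automorphism_def orthogonal_transformation_bij)

lemma root_automorphism_inv: "root_automorphism w \<Longrightarrow> root_automorphism (inv_into UNIV w)"
  by (metis bij_def image_inv_f_f orthogonal_transformation_inv root_automorphism_bij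
      root_automorphism_def)

lemma root_automorphism_uminus: "root_automorphism w \<Longrightarrow> w (- x) = - w x"
  by (simp add: root_automorphism_def orthogonal_transformation_def linear_neg)

lemma root_automorphism_reflection_comp:
  "root_automorphism w \<Longrightarrow> w \<circ> reflection a = reflection (w a) \<circ> w"
  by (simp add: fun_eq_iff orthogonal_transformation_reflection_conj root_automorphism_def)

section \<open>Inversion sets under right multiplication by a simple reflection\<close>

lemma neg_image_iff:
  assumes "root_automorphism w" "\<beta> \<in> \<Phi>"
  shows "\<beta> \<in> w ` Neg \<longleftrightarrow> \<beta> \<notin> w ` Pos"
proof -
  have "w ` Pos \<inter> w ` Neg = {}"
    using root_automorphism_bij[OF assms(1)] pos_inter_neg
    by (metis bij_def image_Int image_empty)
  moreover have "\<beta> \<in> w ` Pos \<union> w ` Neg"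
    using assms root_iff unfolding root_automorphism_def by blast
  ultimately show ?thesis by auto
qed

lemma uminus_mem_image_neg: "root_automorphism w \<Longrightarrow> - \<beta> \<in> w ` Neg \<longleftrightarrow> \<beta> \<in> w ` Pos"
proof -
  assume w: "root_automorphism w"
  have "w ` Neg = uminus ` (w ` Pos)"
    by (simp add: negative_roots_def image_image root_automorphism_uminus[OF w])
  then show ?thesis by force
qed

lemma mem_Inv: "root_automorphism w \<Longrightarrow> \<beta> \<in> Inv w \<longleftrightarrow> \<beta> \<in> Pos \<and> \<beta> \<notin> w ` Pos"
  using neg_image_iff pos_subset by (auto simp: inversions_def)

lemma finite_Inv: "finite (Inv w)"
  using finite_pos by (simp add: inversions_def)

lemma mem_Inv_image_simple:
  assumes "root_automorphism w" "\<alpha> \<in> \<Delta>" "w \<alpha> \<in> Neg"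
  shows "- w \<alpha> \<in> Inv w"
  using assms by (simp add: inversions_def uminus_mem_pos uminus_mem_image_neg simple_pos)

lemma mem_image_comp_reflection:
  "\<beta> \<in> (w \<circ> reflection \<alpha>) ` Pos \<longleftrightarrow> (\<exists>\<gamma>. \<beta> = w \<gamma> \<and> reflection \<alpha> \<gamma> \<in> Pos)"
  by (metis (no_types, lifting) comp_apply image_iff reflection_involution)

text \<open>The reflection permutes the negative roots other than - \<alpha>, so the only possible
  new inversion is the image of - \<alpha>, namely \<open>w \<alpha>\<close>.\<close>

lemma Inv_comp_subset:
  assumes w: "root_automorphism w" and a: "\<alpha> \<in> \<Delta>"
  shows "Inv (w \<circ> reflection \<alpha>) \<subseteq> insert (w \<alpha>) (Inv w)"
proof
  fix \<beta> assume "\<beta> \<in> Inv (w \<circ> reflection \<alpha>)"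
  then obtain \<nu> where n: "\<nu> \<in> Neg" "\<beta> = w (reflection \<alpha> \<nu>)" and b: "\<beta> \<in> Pos"
    by (auto simp: inversions_def)
  show "\<beta> \<in> insert (w \<alpha>) (Inv w)"
  proof (cases "\<nu> = - \<alpha>")
    case True
    then have "reflection \<alpha> \<nu> = \<alpha>" using a simple_reflection_self reflection_involution by metis
    then show ?thesis using n by simp
  next
    case False
    then show ?thesis using simple_reflection_neg[OF a n(1)] n(2) b by (auto simp: inversions_def)
  qed
qed

text \<open>A descent loses exactly one inversion. This drives both inductions on
  \<open>card (Inv w)\<close> for linear extensions.\<close>

lemma Inv_comp_neg:
  assumes w: "root_automorphism w" and a: "\<alpha> \<in> \<Delta>" and neg: "w \<alpha> \<in> Neg"
  shows "Inv (w \<circ> reflection \<alpha>) = Inv w - {- w \<alpha>}"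
proof -
  have v: "root_automorphism (w \<circ> reflection \<alpha>)"
    using w a simple_subset root_automorphism_comp root_automorphism_reflection by blast
  have "(w \<circ> reflection \<alpha>) \<alpha> = - w \<alpha>"
    using simple_reflection_self[OF a] root_automorphism_uminus[OF w] by simp
  then have "- w \<alpha> \<in> (w \<circ> reflection \<alpha>) ` Pos"
    using simple_pos[OF a] by (metis imageI)
  then have 1: "- w \<alpha> \<notin> Inv (w \<circ> reflection \<alpha>)" using mem_Inv[OF v] by auto
  have 2: "w \<alpha> \<notin> Inv (w \<circ> reflection \<alpha>)"
    using neg pos_inter_neg by (auto simp: inversions_def)
  have 3: "\<beta> \<in> Inv (w \<circ> reflection \<alpha>)" if b: "\<beta> \<in> Inv w" "\<beta> \<noteq> - w \<alpha>" for \<beta>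
  proof -
    obtain \<nu> where n: "\<nu> \<in> Neg" "\<beta> = w \<nu>" using b by (auto simp: inversions_def)
    then have "\<nu> \<noteq> - \<alpha>" using b root_automorphism_uminus[OF w] by auto
    then have "reflection \<alpha> \<nu> \<in> Neg" using simple_reflection_neg a n by blast
    moreover have "\<beta> = (w \<circ> reflection \<alpha>) (reflection \<alpha> \<nu>)"
      by (simp add: n reflection_involution)
    ultimately show ?thesis using b by (auto simp: inversions_def)
  qed
  show ?thesis using 1 2 3 Inv_comp_subset[OF w a] by auto
qed

lemma Inv_comp_pos:
  assumes w: "root_automorphism w" and a: "\<alpha> \<in> \<Delta>" and pos: "w \<alpha> \<in> Pos"
  shows "Inv w = Inv (w \<circ> reflection \<alpha>) - {w \<alpha>}" "w \<alpha> \<in> Inv (w \<circ> reflection \<alpha>)"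
proof -
  let ?v = "w \<circ> reflection \<alpha>"
  have v: "root_automorphism ?v"
    using w a simple_subset root_automorphism_comp root_automorphism_reflection by blast
  have va: "?v \<alpha> = - w \<alpha>"
    using simple_reflection_self[OF a] root_automorphism_uminus[OF w] by simp
  \<comment> \<open>The product \<open>?v\<close> has a descent at \<alpha>, so the ascent case is
    the descent case for \<open>?v\<close>.\<close>
  have "?v \<circ> reflection \<alpha> = w" by (simp add: comp_assoc reflection_comp_self)
  moreover have "?v \<alpha> \<in> Neg" using va pos uminus_mem_neg by metis
  ultimately show "Inv w = Inv ?v - {w \<alpha>}" "w \<alpha> \<in> Inv ?v"
    using Inv_comp_neg[OF v a] mem_Inv_image_simple[OF v a] va by simp_all
qed

subsection \<open>Inversions along a word, and the length function\<close>

lemma Inv_id: "Inv id = {}"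
  using pos_inter_neg by (simp add: inversions_def)

lemma root_function_eq:
  "root_function \<Delta> Q I k = prefix_prod Q I k (simple_root \<Delta> (Q ! k))"
  by (simp add: root_function_def prefix_prod_def)

context
  fixes Q
  assumes Q: "set Q \<subseteq> simple_reflections \<Delta>"
begin

abbreviation root_at where "root_at \<equiv> root_function \<Delta> Q"

lemma letter:
  assumes "k < length Q"
  shows "simple_root \<Delta> (Q ! k) \<in> \<Delta>" "reflection (simple_root \<Delta> (Q ! k)) = Q ! k"
  using simple_root Q assms nth_mem by blast+

lemma root_automorphism_letter: "k < length Q \<Longrightarrow> root_automorphism (Q ! k)"
  by (metis letter root_automorphism_reflection simple_subset subsetD)

lemma root_automorphism_prefix:
  "k \<le> length Q \<Longrightarrow> root_automorphism (prefix_prod Q I k)"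
  by (induction k)
    (simp_all add: prefix_prod_0 prefix_prod_Suc root_automorphism_id root_automorphism_comp
      root_automorphism_letter)

lemma root_at_mem: "k < length Q \<Longrightarrow> root_at I k \<in> \<Phi>"
  using root_automorphism_prefix[of k I] letter(1)[of k] simple_subset
  by (auto simp: root_function_eq root_automorphism_def)

lemma prefix_comp_letter:
  "k < length Q \<Longrightarrow> prefix_prod Q I k \<circ> Q ! k = reflection (root_at I k) \<circ> prefix_prod Q I k"
  using root_automorphism_reflection_comp[OF root_automorphism_prefix] letter(2)
  by (metis less_imp_le root_function_eq)

text \<open>Each letter outside \<open>I\<close> contributes at most its own root. Equality can
  fail, since the subword need not be reduced.\<close>

lemma Inv_prefix_subset:
  "k \<le> length Q \<Longrightarrow> Inv (prefix_prod Q I k) \<subseteq> root_at I ` ({..<k} - I)"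
proof (induction k)
  case 0
  then show ?case by (simp add: prefix_prod_0 Inv_id del: id_apply)
next
  case (Suc k)
  then have k: "k < length Q" by simp
  have IH: "Inv (prefix_prod Q I k) \<subseteq> root_at I ` ({..<k} - I)" using Suc by simp
  show ?case
  proof (cases "k \<in> I")
    case True
    then show ?thesis using IH by (auto simp: prefix_prod_Suc[OF k])
  next
    case False
    have "Inv (prefix_prod Q I (Suc k)) \<subseteq> insert (root_at I k) (Inv (prefix_prod Q I k))"
      using Inv_comp_subset[OF root_automorphism_prefix letter(1)[OF k], of k I] k False
      by (simp add: prefix_prod_Suc letter root_function_eq)
    moreover have "{..<Suc k} - I = insert k ({..<k} - I)" using False by auto
    ultimately show ?thesis using IH by auto
  qed
qed

text \<open>Inserting or deleting the letter at \<open>a\<close> multiplies the prefix on the left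
  by the reflection in the root at \<open>a\<close>; later letters multiply on the right and leave
  that factor alone.\<close>

lemma prefix_toggle:
  assumes a: "a < length Q"
  shows "k \<le> length Q \<Longrightarrow> prefix_prod Q (toggle a I) k =
    (if k \<le> a then prefix_prod Q I k else reflection (root_at I a) \<circ> prefix_prod Q I k)"
proof (induction k)
  case 0
  then show ?case by (simp add: prefix_prod_0 del: id_apply)
next
  case (Suc k)
  then have k: "k < length Q" by simp
  consider "k < a" | "k = a" | "a < k" by linarith
  then show ?case
  proof cases
    case 2
    then show ?thesis using Suc k
      by (simp add: prefix_prod_Suc mem_toggle prefix_comp_letter reflection_comp_comp del: comp_apply)
  qed (use Suc k in \<open>simp_all add: prefix_prod_Suc mem_toggle comp_assoc del: comp_apply\<close>)
qed

lemma root_at_toggle: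
  assumes "a < length Q" "k < length Q"
  shows "root_at (toggle a I) k =
    (if k \<le> a then root_at I k else reflection (root_at I a) (root_at I k))"
  using assms by (simp add: root_function_eq prefix_toggle)

lemma card_Inv_prefix: "k \<le> length Q \<Longrightarrow> card (Inv (prefix_prod Q I k)) \<le> card ({..<k} - I)"
  using Inv_prefix_subset[of k I] by (meson finite_Diff finite_lessThan surj_card_le)

end

section \<open>The exchange condition and the length as number of inversions\<close>

lemma root_automorphism_word_prod:
  "set ws \<subseteq> simple_reflections \<Delta> \<Longrightarrow> root_automorphism (word_prod ws)"
  by (metis order_refl prefix_prod_full root_automorphism_prefix)

lemma card_Inv_word_prod:
  "set ws \<subseteq> simple_reflections \<Delta> \<Longrightarrow> card (Inv (word_prod ws)) \<le> length ws"
  using card_Inv_prefix[of ws "length ws" "{}"] by (simp add: prefix_prod_full)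

text \<open>The inversion is the root at some position of the word; deleting the letter there
  multiplies the product by its reflection.\<close>

lemma exchange_condition:
  assumes ws: "set ws \<subseteq> simple_reflections \<Delta>" and b: "\<beta> \<in> Inv (word_prod ws)"
  obtains vs where "set vs \<subseteq> simple_reflections \<Delta>" "length ws = Suc (length vs)"
    "word_prod vs = reflection \<beta> \<circ> word_prod ws"
proof -
  have "\<beta> \<in> root_function \<Delta> ws {} ` {..<length ws}"
    using Inv_prefix_subset[OF ws order_refl, of "{}"] b by (auto simp: prefix_prod_full)
  then obtain j where j: "j < length ws" "\<beta> = root_function \<Delta> ws {} j" by auto
  let ?vs = "nths ws ({..<length ws} - {j})"
  have "word_prod ?vs = reflection \<beta> \<circ> word_prod ws"
    using prefix_toggle[OF ws j(1) order_refl, of "{}"] j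
    by (simp add: prefix_prod_full toggle_def) (simp add: prefix_prod_def)
  moreover have "length ws = Suc (length ?vs)"
    using j by (simp add: length_nths_lessThan)
  ultimately show thesis using that ws set_nths_subset by (metis subset_trans)
qed

text \<open>Induction on the last letter: at an ascent the letter is appended to the short word, at
  a descent it is absorbed by the exchange condition, which removes a letter.\<close>

lemma short_word:
  "set ws \<subseteq> simple_reflections \<Delta> \<Longrightarrow>
     \<exists>vs. set vs \<subseteq> simple_reflections \<Delta> \<and> word_prod vs = word_prod ws \<and>
       length vs \<le> card (Inv (word_prod ws))"
proof (induction ws rule: rev_induct)
  case Nil
  show ?case by (intro exI[of _ "[]"]) simp
next
  case (snoc s ws)
  let ?u = "word_prod ws"
  have ws: "set ws \<subseteq> simple_reflections \<Delta>" and s: "s \<in> simple_reflections \<Delta>"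
    using snoc.prems by auto
  obtain \<alpha> where a: "\<alpha> \<in> \<Delta>" "s = reflection \<alpha>" using s by (auto simp: simple_reflections_def)
  have u: "root_automorphism ?u" using ws by (rule root_automorphism_word_prod)
  have us: "word_prod (ws @ [s]) = ?u \<circ> reflection \<alpha>"
    by (simp add: word_prod_append a) (simp add: word_prod_def)
  obtain vs where vs: "set vs \<subseteq> simple_reflections \<Delta>" "word_prod vs = ?u"
      "length vs \<le> card (Inv ?u)"
    using snoc.IH ws by auto
  have "?u \<alpha> \<in> \<Phi>" using u a simple_subset by (auto simp: root_automorphism_def)
  then consider "?u \<alpha> \<in> Pos" | "?u \<alpha> \<in> Neg" using root_iff by blast
  then show ?case
  proof cases
    case 1
    have "card (Inv (?u \<circ> reflection \<alpha>)) = Suc (card (Inv ?u))"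
      using Inv_comp_pos[OF u a(1) 1] finite_Inv by (metis card_Suc_Diff1)
    then have "length (vs @ [s]) \<le> card (Inv (word_prod (ws @ [s])))"
      using vs us by simp
    moreover have "word_prod (vs @ [s]) = word_prod (ws @ [s])"
      by (simp add: word_prod_append vs)
    ultimately show ?thesis using vs s by (intro exI[of _ "vs @ [s]"]) simp
  next
    case 2
    have m: "- ?u \<alpha> \<in> Inv ?u" using mem_Inv_image_simple u a 2 by blast
    then obtain xs where xs: "set xs \<subseteq> simple_reflections \<Delta>" "length vs = Suc (length xs)"
        "word_prod xs = reflection (- ?u \<alpha>) \<circ> ?u"
      using exchange_condition[OF vs(1), unfolded vs(2)] by metis
    have "word_prod xs = word_prod (ws @ [s])"
      using xs us root_automorphism_reflection_comp[OF u, of \<alpha>] by (simp add: reflection_uminus_root)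
    moreover have "Suc (card (Inv (word_prod (ws @ [s])))) = card (Inv ?u)"
      unfolding us Inv_comp_neg[OF u a(1) 2] using m finite_Inv by (rule card_Suc_Diff1[rotated])
    ultimately show ?thesis using xs vs by (intro exI[of _ xs]) simp
  qed
qed

lemma coxeter_length_word_prod:
  assumes "set ws \<subseteq> simple_reflections \<Delta>"
  shows "coxeter_length \<Delta> (word_prod ws) = card (Inv (word_prod ws))"
  unfolding coxeter_length_def
proof (rule Least_equality)
  show "\<exists>vs. set vs \<subseteq> simple_reflections \<Delta> \<and> word_prod vs = word_prod ws \<and>
      length vs = card (Inv (word_prod ws))"
    using short_word[OF assms] card_Inv_word_prod by (metis le_antisym)
qed (use card_Inv_word_prod in metis)

section \<open>Elements of the generated group\<close>

lemma coxeter_group_induct [consumes 1, case_names id reflection comp]: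
  assumes "w \<in> coxeter_group \<Delta>" and "P id" and "\<And>\<alpha>. \<alpha> \<in> \<Delta> \<Longrightarrow> P (reflection \<alpha>)"
    and "\<And>u v. P u \<Longrightarrow> P v \<Longrightarrow> P (u \<circ> v)"
  shows "P w"
proof -
  let ?G = "BijGroup (UNIV :: 'a set)"
  have bij: "reflection \<alpha> \<in> Bij UNIV" for \<alpha> :: 'a
    by (simp add: Bij_def orthogonal_transformation_bij orthogonal_transformation_reflection)
  \<comment> \<open>Bijectivity is carried along because multiplication and inversion in
    \<open>BijGroup\<close> have their usual meaning on bijections only. The inverse case reduces to
    the generators, which are involutions.\<close>
  have "w \<in> Bij UNIV \<and> P w"
    using assms(1) unfolding coxeter_group_def
  proof (induction rule: generate.induct)
    case one
    have "\<one>\<^bsub>?G\<^esub> = id" by (simp add: BijGroup_def restrict_UNIV id_def)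
    moreover have "id \<in> Bij (UNIV :: 'a set)" by (simp add: Bij_def)
    ultimately show ?case using assms(2) by (simp del: id_apply)
  next
    case (incl h)
    then show ?case using assms(3) bij by (auto simp: simple_reflections_def)
  next
    case (inv h)
    then obtain \<alpha> where a: "\<alpha> \<in> \<Delta>" "h = reflection \<alpha>" by (auto simp: simple_reflections_def)
    have "m_inv ?G h = inv_into UNIV h"
      using inv_BijGroup[OF bij[of \<alpha>]] a by (simp add: restrict_UNIV)
    also have "\<dots> = h"
      using a reflection_comp_self[of \<alpha>] by (metis inv_unique_comp)
    finally show ?case using a assms(3) bij by simp
  next
    case (eng u v)
    then have "u \<otimes>\<^bsub>?G\<^esub> v = u \<circ> v"
      by (simp add: BijGroup_def compose_def restrict_UNIV comp_def)
    moreover have "u \<circ> v \<in> Bij UNIV" using eng by (simp add: Bij_def bij_comp)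
    ultimately show ?case using eng assms(4) by (simp del: comp_apply)
  qed
  then show ?thesis ..
qed

lemma root_automorphism_coxeter: "w \<in> coxeter_group \<Delta> \<Longrightarrow> root_automorphism w"
proof (induction rule: coxeter_group_induct)
  case (reflection \<alpha>)
  then show ?case using root_automorphism_reflection simple_subset by blast
qed (simp_all add: root_automorphism_id root_automorphism_comp del: id_apply comp_apply)

lemma coxeter_comp_reflection:
  assumes "w \<in> coxeter_group \<Delta>" "\<alpha> \<in> \<Delta>"
  shows "w \<circ> reflection \<alpha> \<in> coxeter_group \<Delta>"
proof -
  have r: "reflection \<alpha> \<in> coxeter_group \<Delta>"
    using assms(2) by (auto simp: coxeter_group_def simple_reflections_def intro: generate.incl)
  have "w \<in> Bij UNIV" "reflection \<alpha> \<in> Bij UNIV"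
    using assms root_automorphism_coxeter root_automorphism_bij r by (auto simp: Bij_def)
  then have "w \<otimes>\<^bsub>BijGroup UNIV\<^esub> reflection \<alpha> = w \<circ> reflection \<alpha>"
    by (simp add: BijGroup_def compose_def restrict_UNIV comp_def)
  then show ?thesis using assms(1) r generate.eng unfolding coxeter_group_def by metis
qed

subsection \<open>Facets and flips\<close>

context
  fixes Q and \<omega> :: "'a \<Rightarrow> 'a"
  assumes Q: "set Q \<subseteq> simple_reflections \<Delta>"
begin

text \<open>Reducedness becomes a count, because the length of the product is its number of
  inversions.\<close>

lemma facet_iff:
  "I \<in> facets \<Delta> Q \<omega> \<longleftrightarrow> I \<subseteq> {..<length Q} \<and> prefix_prod Q I (length Q) = \<omega> \<and>
     card ({..<length Q} - I) = card (Inv \<omega>)"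
proof -
  have s: "set (nths Q ({..<length Q} - I)) \<subseteq> simple_reflections \<Delta>"
    using Q set_nths_subset by (metis subset_trans)
  then show ?thesis using coxeter_length_word_prod[OF s]
    by (auto simp: facets_def reduced_expression_def prefix_prod_def length_nths_lessThan)
qed

lemma facet_roots:
  assumes I: "I \<in> facets \<Delta> Q \<omega>"
  shows "root_at Q I ` ({..<length Q} - I) = Inv \<omega>" "inj_on (root_at Q I) ({..<length Q} - I)"
proof -
  let ?C = "{..<length Q} - I"
  have f: "prefix_prod Q I (length Q) = \<omega>" "card ?C = card (Inv \<omega>)"
    using I by (auto simp: facet_iff)
  \<comment> \<open>The letters outside \<open>I\<close> are just enough to account for all inversions, so none is wasted.\<close>
  have sub: "Inv \<omega> \<subseteq> root_at Q I ` ?C"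
    using Inv_prefix_subset[OF Q order_refl, of I] f by simp
  have le: "card (root_at Q I ` ?C) \<le> card (Inv \<omega>)"
    using card_image_le[of ?C "root_at Q I"] f by simp
  show eq: "root_at Q I ` ?C = Inv \<omega>"
    using card_seteq[OF _ sub le] by simp
  show "inj_on (root_at Q I) ?C" using eq f by (intro eq_card_imp_inj_on) simp_all
qed

lemma facet_complement_pos:
  "I \<in> facets \<Delta> Q \<omega> \<Longrightarrow> k < length Q \<Longrightarrow> k \<notin> I \<Longrightarrow> root_at Q I k \<in> Pos"
  using facet_roots(1)[of I] by (auto simp: inversions_def)

text \<open>A negative root at \<open>k\<close> makes its opposite an inversion of the prefix before
  \<open>k\<close>, hence the root of an earlier letter outside \<open>I\<close>.\<close>

lemma negative_root_occurs_before:
  assumes k: "k < length Q" and neg: "root_at Q I k \<in> Neg"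
  shows "\<exists>j<k. j \<notin> I \<and> root_at Q I j = - root_at Q I k"
proof -
  have "- root_at Q I k \<in> Inv (prefix_prod Q I k)"
    using mem_Inv_image_simple[OF root_automorphism_prefix[OF Q] letter(1)[OF Q k], of k I] k neg
    by (simp add: root_function_eq)
  then have "- root_at Q I k \<in> root_at Q I ` ({..<k} - I)"
    using Inv_prefix_subset[OF Q, of k I] k by auto
  then show ?thesis by force
qed

text \<open>The first toggle maps the root at \<open>b\<close> to plus or minus the root at
  \<open>a\<close>, so the second toggle contributes the same reflection and the two cancel beyond
  \<open>b\<close>.\<close>

lemma reflection_root_at_toggle:
  assumes ab: "a < b" "b < length Q" and r: "root_at Q I b \<in> {root_at Q I a, - root_at Q I a}"
  shows "reflection (root_at Q (toggle a I) b) = reflection (root_at Q I a)"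
proof -
  let ?\<delta> = "root_at Q I a"
  have nz: "?\<delta> \<noteq> 0" using root_at_mem[OF Q, of a I] ab zero_not_root by auto
  then have "reflection ?\<delta> (root_at Q I b) \<in> {?\<delta>, - ?\<delta>}"
    using r by (auto simp: reflection_self reflection_uminus)
  then show ?thesis
    using ab by (auto simp: root_at_toggle[OF Q] reflection_uminus_root)
qed

text \<open>A toggle affects only positions strictly after it. Hence \<open>a\<close> keeps its root
  while \<open>b\<close> is reflected, and beyond \<open>b\<close> both reflections cancel.\<close>

lemma flip_roots:
  assumes ab: "a < b" "b < length Q" and r: "root_at Q I b \<in> {root_at Q I a, - root_at Q I a}"
    and k: "k < length Q"
  shows "root_at Q (toggle b (toggle a I)) k =
    (if a < k \<and> k \<le> b then reflection (root_at Q I a) (root_at Q I k) else root_at Q I k)"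
  using ab k reflection_root_at_toggle[OF ab r]
  by (auto simp: root_at_toggle[OF Q] reflection_involution)

text \<open>The total product survives because the two reflections cancel, and the number of letters
  because exactly one of \<open>a\<close>, \<open>b\<close> lies in \<open>I\<close>.\<close>

lemma flip_facet:
  assumes ab: "a < b" "b < length Q" and r: "root_at Q I b \<in> {root_at Q I a, - root_at Q I a}"
    and I: "I \<in> facets \<Delta> Q \<omega>" and one: "(a \<in> I) \<noteq> (b \<in> I)"
  shows "toggle b (toggle a I) \<in> facets \<Delta> Q \<omega>"
proof -
  let ?J = "toggle b (toggle a I)" and ?m = "length Q"
  have "prefix_prod Q ?J ?m = prefix_prod Q I ?m"
    using ab by (simp add: prefix_toggle[OF Q] reflection_root_at_toggle[OF ab r]
        reflection_comp_comp)
  moreover have "?J \<subseteq> {..<?m}" using I ab by (auto simp: facet_iff mem_toggle split: if_splits)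
  moreover have "card ({..<?m} - ?J) = card ({..<?m} - I)"
  proof (cases "a \<in> I")
    case True
    then have "{..<?m} - ?J = insert a (({..<?m} - I) - {b})" using one ab
      by (auto simp: mem_toggle split: if_splits)
    moreover have "b \<in> {..<?m} - I" using True one ab by simp
    ultimately show ?thesis using True by (simp add: card.insert_remove card_Suc_Diff1 del: card_Diff_insert)
  next
    case False
    then have "{..<?m} - ?J = insert b (({..<?m} - I) - {a})" using one ab
      by (auto simp: mem_toggle split: if_splits)
    moreover have "a \<in> {..<?m} - I" using False one ab by simp
    ultimately show ?thesis using False one by (simp add: card.insert_remove card_Suc_Diff1 del: card_Diff_insert)
  qed
  ultimately show ?thesis using I by (simp add: facet_iff)
qed

section \<open>Comparing two facets at their last difference\<close>

lemma prefix_eq_if_agree_above: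
  assumes "n \<le> length Q" and "\<And>j. n \<le> j \<Longrightarrow> j < length Q \<Longrightarrow> j \<in> I \<longleftrightarrow> j \<in> J"
    and "prefix_prod Q I (length Q) = prefix_prod Q J (length Q)"
  shows "prefix_prod Q I n = prefix_prod Q J n"
  using assms(1)
proof (induction n rule: inc_induct)
  case base
  show ?case by (rule assms(3))
next
  case (step n)
  have "Q ! n \<circ> Q ! n = id"
    using letter(2)[OF Q step.hyps(2)] reflection_comp_self by metis
  then have cancel: "f = g" if "f \<circ> Q ! n = g \<circ> Q ! n" for f g :: "'a \<Rightarrow> 'a"
    using that by (metis comp_assoc comp_id)
  show ?case
    using step.IH assms(2)[OF step.hyps(1,2)]
      cancel[of "prefix_prod Q I n" "prefix_prod Q J n"]
    by (cases "n \<in> J") (simp_all add: prefix_prod_Suc step.hyps(2) del: comp_apply)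
qed

text \<open>If \<open>I\<close> and \<open>J\<close> agree after \<open>k\<close>, cancelling
  letters from the right equates their prefixes through \<open>k\<close>. Only \<open>J\<close> uses
  letter \<open>k\<close>, so the two roots at \<open>k\<close> are opposite; the one for
  \<open>J\<close> is positive because \<open>k\<close> is outside \<open>J\<close>.\<close>

lemma last_difference_not_both_positive:
  assumes I: "I \<in> facets \<Delta> Q \<omega>" "k \<in> I" "root_at Q I k \<in> Pos"
    and J: "J \<in> facets \<Delta> Q \<omega>" "k \<notin> J"
  shows "\<exists>j>k. j < length Q \<and> (j \<in> I \<longleftrightarrow> j \<notin> J)"
proof (rule ccontr)
  assume "\<not> ?thesis"
  then have agree: "j \<in> I \<longleftrightarrow> j \<in> J" if "Suc k \<le> j" "j < length Q" for j
    using that by (auto simp: Suc_le_eq)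
  have k: "k < length Q" using I by (auto simp: facet_iff)
  define \<alpha> where "\<alpha> = simple_root \<Delta> (Q ! k)"
  have \<alpha>: "\<alpha> \<in> \<Delta>" "Q ! k = reflection \<alpha>" using letter[OF Q k] by (simp_all add: \<alpha>_def)
  have "prefix_prod Q I (Suc k) = prefix_prod Q J (Suc k)"
    by (rule prefix_eq_if_agree_above) (use k agree I J in \<open>auto simp: facet_iff\<close>)
  then have "prefix_prod Q I k = prefix_prod Q J k \<circ> reflection \<alpha>"
    using I J k \<alpha> by (simp add: prefix_prod_Suc)
  then have "root_at Q I k = prefix_prod Q J k (- \<alpha>)"
    using simple_reflection_self[OF \<alpha>(1)] by (simp add: root_function_eq flip: \<alpha>_def)
  also have "\<dots> = - root_at Q J k"
    using root_automorphism_uminus[OF root_automorphism_prefix[OF Q]] k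
    by (simp add: root_function_eq \<alpha>_def)
  finally have "root_at Q J k \<in> Neg" using I(3) by (simp add: uminus_mem_pos)
  then show False using facet_complement_pos[OF J(1) k J(2)] pos_inter_neg by auto
qed

lemma positive_facet_unique:
  assumes I: "I \<in> facets \<Delta> Q \<omega>" "\<forall>i\<in>I. root_at Q I i \<in> Pos"
    and J: "J \<in> facets \<Delta> Q \<omega>" "\<forall>i\<in>J. root_at Q J i \<in> Pos"
  shows "I = J"
proof (rule ccontr)
  assume "I \<noteq> J"
  define D where "D = {k. k < length Q \<and> (k \<in> I \<longleftrightarrow> k \<notin> J)}"
  have fin: "finite D" by (simp add: D_def)
  have "I \<subseteq> {..<length Q}" "J \<subseteq> {..<length Q}" using I J by (auto simp: facet_iff)
  then have "D \<noteq> {}" using \<open>I \<noteq> J\<close> by (auto simp: D_def)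
  then have "Max D \<in> D" using fin by (rule Max_in[rotated])
  moreover have "j \<notin> D" if "j > Max D" for j using that fin Max_ge leD by blast
  ultimately show False
    using last_difference_not_both_positive[of I "Max D" J]
      last_difference_not_both_positive[of J "Max D" I] I J
    unfolding D_def by blast
qed

section \<open>Removing a descent from a linear extension\<close>

definition root_positions :: "nat set \<Rightarrow> 'a \<Rightarrow> nat set" where
  "root_positions I \<delta> = {k. k < length Q \<and> root_at Q I k \<in> {\<delta>, - \<delta>}}"

text \<open>In the second branch this is the flip of the outermost positions carrying \<delta> up to
  sign, once the first is known to lie outside \<open>I\<close> and the last inside.\<close>

definition shift_facet :: "'a \<Rightarrow> nat set \<Rightarrow> nat set" where
  "shift_facet \<delta> I = (let A = root_positions I \<delta> in
     if A \<inter> I = {} then I else insert (Min A) (I - {Max A}))"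

lemma finite_root_positions: "finite (root_positions I \<delta>)"
  by (simp add: root_positions_def)

text \<open>Only the pair \<delta>, - \<delta> changes sides between the positive systems of \<pi>
  and \<pi> s_\<alpha>. The flip spans every position of \<open>I\<close> carrying - \<delta> and
  turns those roots into \<delta>. The last two conclusions are what allows the flip to be
  undone.\<close>

lemma shift_facet:
  assumes I: "I \<in> facets \<Delta> Q \<omega>" "\<forall>i\<in>I. root_at Q I i \<in> \<pi> ` Pos"
    and \<pi>: "root_automorphism \<pi>" and \<alpha>: "\<alpha> \<in> \<Delta>" "\<pi> \<alpha> \<in> Neg" and \<delta>: "\<delta> = - \<pi> \<alpha>"
  defines "J \<equiv> shift_facet \<delta> I" and "A \<equiv> root_positions I \<delta>"
  shows "J \<in> facets \<Delta> Q \<omega>" "\<forall>i\<in>J. root_at Q J i \<in> (\<pi> \<circ> reflection \<alpha>) ` Pos"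
    "root_positions J \<delta> = A" "A \<inter> I \<noteq> {} \<Longrightarrow> Min A \<notin> I \<and> Max A \<in> I"
proof -
  have ref: "reflection \<delta> (\<pi> \<gamma>) = \<pi> (reflection \<alpha> \<gamma>)" for \<gamma>
    using \<pi> by (simp add: \<delta> reflection_uminus_root root_automorphism_def
        orthogonal_transformation_reflection_conj)
  \<comment> \<open>Both forms are needed, since a root of the configuration may lie inside or
    outside the flipped range.\<close>
  have pos: "\<pi> \<gamma> \<in> (\<pi> \<circ> reflection \<alpha>) ` Pos" "reflection \<delta> (\<pi> \<gamma>) \<in> (\<pi> \<circ> reflection \<alpha>) ` Pos"
    if "\<gamma> \<in> Pos" "\<pi> \<gamma> \<noteq> - \<delta>" for \<gamma>
  proof -
    have "\<gamma> \<noteq> \<alpha>" using that \<delta> by auto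
    then have "reflection \<alpha> \<gamma> \<in> Pos" using simple_reflection_pos \<alpha> that by blast
    then show "\<pi> \<gamma> \<in> (\<pi> \<circ> reflection \<alpha>) ` Pos"
      unfolding mem_image_comp_reflection by blast
    show "reflection \<delta> (\<pi> \<gamma>) \<in> (\<pi> \<circ> reflection \<alpha>) ` Pos"
      using that by (auto simp: ref)
  qed
  have \<delta>_image: "\<delta> \<in> (\<pi> \<circ> reflection \<alpha>) ` Pos"
    using simple_pos[OF \<alpha>(1)] simple_reflection_self[OF \<alpha>(1)] root_automorphism_uminus[OF \<pi>]
    by (intro image_eqI[of _ _ \<alpha>]) (simp_all add: \<delta>)
  have \<delta>_pos: "\<delta> \<in> Pos" using \<alpha> by (simp add: \<delta> uminus_mem_pos)
  then have nz: "\<delta> \<noteq> 0" using pos_subset zero_not_root by auto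
  have \<delta>_neg: "- \<delta> \<notin> Pos" using \<delta>_pos pos_inter_neg uminus_mem_pos by auto
  have "\<delta> \<in> \<pi> ` Neg" using uminus_mem_image_neg[OF \<pi>] simple_pos \<alpha> by (simp add: \<delta>)
  then have \<delta>_out: "\<delta> \<notin> \<pi> ` Pos" using neg_image_iff[OF \<pi>] \<delta>_pos pos_subset by blast
  have len: "i < length Q" if "i \<in> I" for i using that I by (auto simp: facet_iff)
  have "J \<in> facets \<Delta> Q \<omega> \<and> (\<forall>i\<in>J. root_at Q J i \<in> (\<pi> \<circ> reflection \<alpha>) ` Pos) \<and>
    root_positions J \<delta> = A \<and> (A \<inter> I \<noteq> {} \<longrightarrow> Min A \<notin> I \<and> Max A \<in> I)"
  proof (cases "A \<inter> I = {}")
    case True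
    then have "J = I" by (simp add: J_def A_def shift_facet_def)
    moreover have "root_at Q I i \<in> (\<pi> \<circ> reflection \<alpha>) ` Pos" if i: "i \<in> I" for i
    proof -
      obtain \<gamma> where "\<gamma> \<in> Pos" "root_at Q I i = \<pi> \<gamma>" using I i by blast
      moreover have "root_at Q I i \<noteq> - \<delta>"
        using True i len by (auto simp: A_def root_positions_def)
      ultimately show ?thesis using pos(1) by simp
    qed
    ultimately show ?thesis using I True by (simp add: A_def)
  next
    case False
    have in_I: "root_at Q I i = - \<delta> \<and> (\<exists>j<i. j \<notin> I \<and> root_at Q I j = \<delta>)" if i: "i \<in> A" "i \<in> I" for i
    proof -
      have eq: "root_at Q I i = - \<delta>"
        using i I \<delta>_out by (auto simp: A_def root_positions_def)
      then have "root_at Q I i \<in> Neg" using \<delta>_pos by (simp add: uminus_mem_neg)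
      then show ?thesis using negative_root_occurs_before[OF len[OF i(2)], of I] eq by simp
    qed
    obtain i0 where i0: "i0 \<in> A" "i0 \<in> I" using False by auto
    obtain j where j: "j < i0" "j \<notin> I" "root_at Q I j = \<delta>" using in_I[OF i0] by auto
    have jl: "j < length Q" using j len[OF i0(2)] by simp
    have unique: "x = j" if "x < length Q" "x \<notin> I" "root_at Q I x = \<delta>" for x
      using inj_onD[OF facet_roots(2)[OF I(1)], of x j] that j jl by simp
    \<comment> \<open>Outside \<open>I\<close> roots are positive and distinct, so \<delta> occurs
      there only once.\<close>
    have not_in_I: "x = j" if "x \<in> A" "x \<notin> I" for x
    proof -
      have "root_at Q I x \<noteq> - \<delta>"
        using facet_complement_pos[OF I(1)] that \<delta>_neg by (metis (no_types, lifting)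
            A_def mem_Collect_eq root_positions_def)
      then show ?thesis using unique that by (auto simp: A_def root_positions_def)
    qed
    have before: "j < i" if "i \<in> A" "i \<in> I" for i
      using in_I[OF that] unique len[OF that(2)] by (metis less_trans)
    have jA: "j \<in> A" using jl j by (simp add: A_def root_positions_def)
    have fin: "finite A" by (simp add: A_def finite_root_positions)
    have min: "Min A = j"
      using fin jA before not_in_I by (intro Min_eqI) (auto intro: less_imp_le)
    define b where "b = Max A"
    have bA: "b \<in> A" unfolding b_def using fin jA by (intro Max_in) auto
    have "i0 \<le> b" using fin i0 by (simp add: b_def)
    then have jb: "j < b" using j by simp
    then have bI: "b \<in> I" using not_in_I bA by blast
    have bl: "b < length Q" using bI len by blast
    have rb: "root_at Q I b \<in> {root_at Q I j, - root_at Q I j}"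
      using in_I bA bI j by auto
    have J: "J = toggle b (toggle j I)"
      using False jb j bI min by (auto simp: J_def shift_facet_def A_def[symmetric] toggle_def b_def)
    have facet: "J \<in> facets \<Delta> Q \<omega>"
      unfolding J using jb bl rb I(1) by (rule flip_facet) (use j bI in simp)
    have root_J: "root_at Q J k =
        (if j < k \<and> k \<le> b then reflection \<delta> (root_at Q I k) else root_at Q I k)"
      if "k < length Q" for k
      using flip_roots[OF jb bl rb that] j by (simp add: J)
    \<comment> \<open>Reflecting in \<delta> preserves the pair \<delta>, - \<delta>, so the flip
      does not change the set of positions.\<close>
    have swap: "reflection \<delta> x \<in> {\<delta>, - \<delta>} \<longleftrightarrow> x \<in> {\<delta>, - \<delta>}" for x
    proof -
      have fwd: "reflection \<delta> y \<in> {\<delta>, - \<delta>}" if "y \<in> {\<delta>, - \<delta>}" for y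
        using that nz by (auto simp: reflection_self reflection_uminus)
      show ?thesis using fwd[of x] fwd[of "reflection \<delta> x"] reflection_involution by metis
    qed
    have "root_at Q J k \<in> {\<delta>, - \<delta>} \<longleftrightarrow> root_at Q I k \<in> {\<delta>, - \<delta>}" if "k < length Q" for k
      using swap[of "root_at Q I k"] root_J[OF that] by (simp only: simp_thms split: if_split)
    then have A: "root_positions J \<delta> = A"
      unfolding root_positions_def A_def by blast
    have "root_at Q J k \<in> (\<pi> \<circ> reflection \<alpha>) ` Pos" if k: "k \<in> J" for k
    \<comment> \<open>Position \<open>j\<close> enters the facet with its root \<delta> unchanged.
      All others come from \<open>I\<close>: those with root - \<delta> lie in the reflected range,
      the rest are covered by \<open>pos\<close>.\<close>
    proof (cases "k = j")
      case True
      then show ?thesis using jl j \<delta>_image by (simp add: root_J)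
    next
      case False
      then have kI: "k \<in> I" using k bI by (auto simp: J mem_toggle split: if_splits)
      show ?thesis
      proof (cases "root_at Q I k = - \<delta>")
        case True
        then have kA: "k \<in> A" using len[OF kI] by (simp add: A_def root_positions_def)
        then have "j < k \<and> k \<le> b" using before kI fin by (simp add: b_def)
        then have "root_at Q J k = \<delta>"
          using True len[OF kI] nz by (simp add: root_J reflection_uminus reflection_self)
        then show ?thesis using \<delta>_image by simp
      next
        case ne: False
        obtain \<gamma> where "\<gamma> \<in> Pos" "root_at Q I k = \<pi> \<gamma>" using I kI by blast
        then show ?thesis using pos ne len[OF kI] by (simp add: root_J)
      qed
    qed
    then show ?thesis using facet A min j bI b_def by blast
  qed
  then show "J \<in> facets \<Delta> Q \<omega>" "\<forall>i\<in>J. root_at Q J i \<in> (\<pi> \<circ> reflection \<alpha>) ` Pos"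
    "root_positions J \<delta> = A" "A \<inter> I \<noteq> {} \<Longrightarrow> Min A \<notin> I \<and> Max A \<in> I"
    by blast+
qed

lemma card_Inv_comp_neg:
  assumes "root_automorphism w" "\<alpha> \<in> \<Delta>" "w \<alpha> \<in> Neg"
  shows "card (Inv (w \<circ> reflection \<alpha>)) < card (Inv w)"
  unfolding Inv_comp_neg[OF assms]
  using finite_Inv mem_Inv_image_simple[OF assms] by (rule card_Diff1_less)

subsection \<open>Linear extensions\<close>

text \<open>Descent on inversions: by induction the shifted facets coincide, and shifting is
  injective on the facets having \<pi> as a linear extension.\<close>

lemma linear_extension_unique:
  assumes "\<pi> \<in> coxeter_group \<Delta>"
    and "I \<in> facets \<Delta> Q \<omega>" "\<forall>i\<in>I. root_at Q I i \<in> \<pi> ` Pos"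
    and "J \<in> facets \<Delta> Q \<omega>" "\<forall>i\<in>J. root_at Q J i \<in> \<pi> ` Pos"
  shows "I = J"
  using assms
proof (induction "card (Inv \<pi>)" arbitrary: \<pi> I J rule: less_induct)
  case less
  have \<pi>: "root_automorphism \<pi>" using less.prems(1) by (rule root_automorphism_coxeter)
  show ?case
  proof (cases "\<exists>\<alpha>\<in>\<Delta>. \<pi> \<alpha> \<in> Neg")
    case True
    then obtain \<alpha> where \<alpha>: "\<alpha> \<in> \<Delta>" "\<pi> \<alpha> \<in> Neg" by blast
    define \<delta> where "\<delta> = - \<pi> \<alpha>"
    note sI = shift_facet[OF less.prems(2,3) \<pi> \<alpha> \<delta>_def]
    note sJ = shift_facet[OF less.prems(4,5) \<pi> \<alpha> \<delta>_def]
    have eq: "shift_facet \<delta> I = shift_facet \<delta> J"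
      using less.hyps[OF card_Inv_comp_neg[OF \<pi> \<alpha>] coxeter_comp_reflection[OF less.prems(1) \<alpha>(1)]]
        sI(1,2) sJ(1,2) by blast
    define A where "A = root_positions I \<delta>"
    \<comment> \<open>Shifting preserves the root positions, so the common image forces a common set
      for both facets.\<close>
    have A: "root_positions I \<delta> = A" "root_positions J \<delta> = A"
      using sI(3) sJ(3) eq by (simp_all add: A_def)
    have min: "Min A \<in> A" if "A \<noteq> {}" using that finite_root_positions A(1) by (metis Min_in)
    have shift: "shift_facet \<delta> K = (if A \<inter> K = {} then K else insert (Min A) (K - {Max A}))"
      if "root_positions K \<delta> = A" for K
      using that by (simp add: shift_facet_def)
    have ends: "A \<inter> I \<noteq> {} \<Longrightarrow> Min A \<notin> I \<and> Max A \<in> I" "A \<inter> J \<noteq> {} \<Longrightarrow> Min A \<notin> J \<and> Max A \<in> J"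
      using sI(4) sJ(4) A by simp_all
    \<comment> \<open>A moved facet contains \<open>Min A\<close> afterwards while a fixed one is
      disjoint from \<open>A\<close>, so mixed cases are impossible.\<close>
    consider "A \<inter> I = {}" "A \<inter> J = {}" | "A \<inter> I = {}" "A \<inter> J \<noteq> {}"
      | "A \<inter> I \<noteq> {}" "A \<inter> J = {}" | "A \<inter> I \<noteq> {}" "A \<inter> J \<noteq> {}" by blast
    then show ?thesis
    proof cases
      case 1
      then show ?thesis using eq by (simp add: shift A)
    next
      case 2
      then have "Min A \<in> A \<inter> I" using eq min by (auto simp: shift A)
      then show ?thesis using 2 by simp
    next
      case 3
      then have "Min A \<in> A \<inter> J" using eq min by (auto simp: shift A)
      then show ?thesis using 3 by simp
    next
      case 4
      then have e: "insert (Min A) (I - {Max A}) = insert (Min A) (J - {Max A})"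
        using eq by (simp add: shift A)
      \<comment> \<open>Both facets omit \<open>Min A\<close> and contain \<open>Max A\<close>, so
        exchanging these positions back recovers each one.\<close>
      show ?thesis using e ends(1)[OF 4(1)] ends(2)[OF 4(2)] by (metis (no_types, lifting)
        Diff_iff Diff_insert_absorb insert_Diff)
    qed
  next
    case False
    have simple: "\<pi> \<alpha> \<in> Pos" if "\<alpha> \<in> \<Delta>" for \<alpha>
      using False that \<pi> simple_subset root_iff unfolding root_automorphism_def by blast
    have "\<pi> \<beta> \<in> Pos" if "\<beta> \<in> Pos" for \<beta>
    proof (rule linear_image_pos[where u = \<pi>])
      show "linear \<pi>" using \<pi> by (simp add: root_automorphism_def orthogonal_transformation_def)
      show "\<pi> \<beta> \<in> \<Phi>" using \<pi> that pos_subset by (auto simp: root_automorphism_def)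
    qed (use simple that in auto)
    then have "\<pi> ` Pos \<subseteq> Pos" by blast
    then show ?thesis using less.prems(2-5) by (intro positive_facet_unique) auto
  qed
qed

text \<open>Descend from \<tau> through simple reflections while staying above \<sigma>, shifting
  the facet each time, until \<tau> and \<sigma> have the same positive system.\<close>

lemma linear_extension_below:
  assumes "\<tau> \<in> coxeter_group \<Delta>" "\<sigma> \<in> coxeter_group \<Delta>" "Inv \<sigma> \<subseteq> Inv \<tau>"
    and "I \<in> facets \<Delta> Q \<omega>" "\<forall>i\<in>I. root_at Q I i \<in> \<tau> ` Pos"
  shows "\<exists>J\<in>facets \<Delta> Q \<omega>. \<forall>i\<in>J. root_at Q J i \<in> \<sigma> ` Pos"
  using assms
proof (induction "card (Inv \<tau>)" arbitrary: \<tau> I rule: less_induct)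
  case less
  have \<tau>: "root_automorphism \<tau>" and \<sigma>: "root_automorphism \<sigma>"
    using less.prems(1,2) root_automorphism_coxeter by blast+
  have \<tau>_root: "\<tau> \<beta> \<in> \<Phi>" if "\<beta> \<in> \<Phi>" for \<beta>
    using that \<tau> by (auto simp: root_automorphism_def)
  show ?case
  proof (cases "\<exists>\<alpha>\<in>\<Delta>. \<tau> \<alpha> \<in> \<sigma> ` Neg")
    case True
    then obtain \<alpha> where \<alpha>: "\<alpha> \<in> \<Delta>" "\<tau> \<alpha> \<in> \<sigma> ` Neg" by blast
    have root: "\<tau> \<alpha> \<in> \<Phi>" using \<tau>_root \<alpha> simple_subset by blast
    \<comment> \<open>If \<open>\<tau> \<alpha>\<close> were positive it would be an inversion of
      \<sigma> but not of \<tau>. So \<alpha> is a descent of \<tau>, and the inversion it removes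
      is not one of \<sigma>.\<close>
    have "\<tau> \<alpha> \<notin> \<tau> ` Neg"
      using neg_image_iff[OF \<tau> root] simple_pos[OF \<alpha>(1)] by blast
    then have "\<tau> \<alpha> \<notin> Inv \<sigma>" using less.prems(3) by (auto simp: inversions_def)
    then have "\<tau> \<alpha> \<notin> Pos" using \<alpha> by (auto simp: inversions_def)
    then have neg: "\<tau> \<alpha> \<in> Neg" using root root_iff by blast
    have "- \<tau> \<alpha> \<in> \<sigma> ` Pos"
      using uminus_mem_image_neg[OF \<sigma>, of "- \<tau> \<alpha>"] \<alpha>(2) by simp
    then have "Inv \<sigma> \<subseteq> Inv (\<tau> \<circ> reflection \<alpha>)"
      using less.prems(3) mem_Inv[OF \<sigma>] unfolding Inv_comp_neg[OF \<tau> \<alpha>(1) neg] by blast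
    then show ?thesis
      using less.hyps[OF card_Inv_comp_neg[OF \<tau> \<alpha>(1) neg]
          coxeter_comp_reflection[OF less.prems(1) \<alpha>(1)] less.prems(2)]
        shift_facet(1,2)[OF less.prems(4,5) \<tau> \<alpha>(1) neg refl] by blast
  next
    case False
    \<comment> \<open>Simple roots are sent by \<open>u\<close> to positive roots, hence all
      positive roots are, which gives inclusion of the positive systems and lets \<open>I\<close>
      itself serve.\<close>
    define u where "u = inv_into UNIV \<sigma> \<circ> \<tau>"
    have u: "root_automorphism u"
      unfolding u_def using root_automorphism_inv root_automorphism_comp \<sigma> \<tau> by blast
    have bij: "bij \<sigma>" using \<sigma> by (rule root_automorphism_bij)
    have \<sigma>u: "\<sigma> (u x) = \<tau> x" for x using bij by (simp add: u_def bij_is_surj surj_f_inv_f)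
    have simple: "u \<alpha> \<in> Pos" if "\<alpha> \<in> \<Delta>" for \<alpha>
    proof -
      have "\<tau> \<alpha> \<in> \<sigma> ` Pos"
        using neg_image_iff[OF \<sigma> \<tau>_root] that False simple_subset by blast
      then show ?thesis using bij by (auto simp: u_def bij_is_inj)
    qed
    have "\<tau> \<beta> \<in> \<sigma> ` Pos" if "\<beta> \<in> Pos" for \<beta>
    proof -
      have "u \<beta> \<in> Pos"
      proof (rule linear_image_pos[where u = u])
        show "linear u" using u by (simp add: root_automorphism_def orthogonal_transformation_def)
        show "u \<beta> \<in> \<Phi>" using u that pos_subset by (auto simp: root_automorphism_def)
      qed (use simple that in auto)
      then show ?thesis using \<sigma>u by (metis imageI)
    qed
    then have "\<tau> ` Pos \<subseteq> \<sigma> ` Pos" by (rule image_subsetI)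
    then show ?thesis using less.prems(4,5) by (meson subsetD)
  qed
qed

text \<open>The sum of positions is the potential: it grows whenever a position of the facet moves
  right.\<close>

lemma linear_extension_top:
  assumes \<omega>: "root_automorphism \<omega>" and ne: "facets \<Delta> Q \<omega> \<noteq> {}"
  shows "\<exists>I\<in>facets \<Delta> Q \<omega>. \<forall>i\<in>I. root_at Q I i \<in> \<omega> ` Pos"
proof -
  have "facets \<Delta> Q \<omega> \<subseteq> Pow {..<length Q}" by (auto simp: facet_iff)
  then have fin: "finite (facets \<Delta> Q \<omega>)" by (rule finite_subset) simp
  then have "Max (sum id ` facets \<Delta> Q \<omega>) \<in> sum id ` facets \<Delta> Q \<omega>" using ne by simp
  then obtain I where I: "I \<in> facets \<Delta> Q \<omega>" and "sum id I = Max (sum id ` facets \<Delta> Q \<omega>)" by auto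
  then have max: "sum id J \<le> sum id I" if "J \<in> facets \<Delta> Q \<omega>" for J :: "nat set"
    using fin that by simp
  have "root_at Q I i \<in> \<omega> ` Pos" if i: "i \<in> I" for i
  proof (rule ccontr)
    assume out: "root_at Q I i \<notin> \<omega> ` Pos"
    have il: "i < length Q" and finI: "finite I"
      using I i finite_subset by (auto simp: facet_iff)
    consider "root_at Q I i \<in> Neg" | "root_at Q I i \<in> Pos"
      using root_at_mem[OF Q il] root_iff by blast
    then show False
    proof cases
      case 1
      then obtain j where "j < i" "j \<notin> I" "root_at Q I j = - root_at Q I i"
        using negative_root_occurs_before il by blast
      then have "- root_at Q I i \<in> root_at Q I ` ({..<length Q} - I)"
        using il by (intro image_eqI[of _ _ j]) simp_all
      then have "- root_at Q I i \<in> Inv \<omega>" using facet_roots(1)[OF I] by simp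
      then have "- root_at Q I i \<in> \<omega> ` Neg" by (simp add: inversions_def)
      then show False using out uminus_mem_image_neg[OF \<omega>] by simp
    next
      case 2
      then have "root_at Q I i \<in> Inv \<omega>" using out mem_Inv[OF \<omega>] by simp
      then have "root_at Q I i \<in> root_at Q I ` ({..<length Q} - I)" using facet_roots(1)[OF I] by simp
      then obtain j where j: "j < length Q" "j \<notin> I" "root_at Q I j = root_at Q I i" by auto
      have "j \<noteq> i" using i j by auto
      then consider "j < i" | "i < j" by linarith
      then show False
      proof cases
        case 1
        \<comment> \<open>The flip would produce a facet with a negative root outside it.\<close>
        let ?J = "toggle i (toggle j I)"
        have r: "root_at Q I i \<in> {root_at Q I j, - root_at Q I j}" using j by simp
        have J: "?J \<in> facets \<Delta> Q \<omega>" using flip_facet[OF 1 il r I] i j by simp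
        have "i \<notin> ?J" using i 1 by (simp add: mem_toggle)
        then have "root_at Q ?J i \<in> Pos" using facet_complement_pos[OF J il] by simp
        moreover have "root_at Q ?J i = - root_at Q I i"
        proof -
          have "root_at Q I i \<noteq> 0" using root_at_mem[OF Q il] zero_not_root by metis
          then show ?thesis
            using flip_roots[OF 1 il r il] 1 j by (simp add: reflection_self)
        qed
        ultimately have "root_at Q I i \<in> Neg" by (simp add: uminus_mem_pos)
        then show False using 2 pos_inter_neg by auto
      next
        \<comment> \<open>The flip replaces \<open>i\<close> by the larger \<open>j\<close>,
          contradicting maximality.\<close>
        case 2
        have r: "root_at Q I j \<in> {root_at Q I i, - root_at Q I i}" using j by simp
        have "toggle j (toggle i I) \<in> facets \<Delta> Q \<omega>" using flip_facet[OF 2 j(1) r I] i j by simp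
        moreover have "toggle j (toggle i I) = insert j (I - {i})"
          using i j 2 by (auto simp: toggle_def)
        ultimately have "sum id (insert j (I - {i})) \<le> sum id I" using max by simp
        moreover have "sum id (insert j (I - {i})) = j + sum id (I - {i})" using finI j by simp
        moreover have "sum id I = i + sum id (I - {i})" using finI i by (simp add: sum.remove)
        ultimately show False using 2 by simp
      qed
    qed
  qed
  then show ?thesis using I by blast
qed

lemma linear_extensions_order_convex:
  assumes I: "I \<in> facets \<Delta> Q \<omega>"
  shows "order_convex \<Phi> \<Delta> (linear_extensions \<Phi> \<Delta> Q I)"
proof -
  have "\<tau> \<in> linear_extensions \<Phi> \<Delta> Q I"
    if \<sigma>: "\<sigma> \<in> linear_extensions \<Phi> \<Delta> Q I" and \<rho>: "\<rho> \<in> linear_extensions \<Phi> \<Delta> Q I"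
      and \<tau>: "\<tau> \<in> coxeter_group \<Delta>" and le: "Inv \<sigma> \<subseteq> Inv \<tau>" "Inv \<tau> \<subseteq> Inv \<rho>" for \<sigma> \<tau> \<rho>
  proof -
    have aut: "root_automorphism \<sigma>" "root_automorphism \<tau>" "root_automorphism \<rho>"
      using \<sigma> \<rho> \<tau> root_automorphism_coxeter by (auto simp: linear_extensions_def)
    have "\<beta> \<in> \<tau> ` Pos" if "\<beta> \<in> \<Phi>" "\<beta> \<in> \<sigma> ` Pos" "\<beta> \<in> \<rho> ` Pos" for \<beta>
    proof (cases "\<beta> \<in> Pos")
      case True
      then show ?thesis using that le aut mem_Inv by blast
    next
      case False
      then have "- \<beta> \<in> Pos" using that root_iff by (simp add: uminus_mem_pos)
      then have "- \<beta> \<in> Inv \<sigma>"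
        using that uminus_mem_image_neg[OF aut(1)] by (simp add: inversions_def)
      then have "- \<beta> \<in> \<tau> ` Neg" using le by (auto simp: inversions_def)
      then show ?thesis using uminus_mem_image_neg[OF aut(2)] by simp
    qed
    moreover have "root_configuration \<Delta> Q I \<subseteq> \<Phi>"
      using I root_at_mem[OF Q] by (auto simp: root_configuration_def facet_iff)
    ultimately show ?thesis using \<sigma> \<rho> \<tau> unfolding linear_extensions_def by blast
  qed
  then show ?thesis
    unfolding order_convex_def weak_less_def weak_le_def
    by (intro conjI ballI impI) (simp add: linear_extensions_def, blast)
qed

section \<open>The union over all facets\<close>

lemma mem_all_linear_extensions:
  "\<pi> \<in> all_linear_extensions \<Phi> \<Delta> Q \<omega> \<longleftrightarrow> \<pi> \<in> coxeter_group \<Delta> \<and>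
     (\<exists>I\<in>facets \<Delta> Q \<omega>. \<forall>i\<in>I. root_at Q I i \<in> \<pi> ` Pos)"
  by (auto simp: all_linear_extensions_def linear_extensions_def root_configuration_def)

lemma all_linear_extensions_lower:
  assumes "\<sigma> \<in> coxeter_group \<Delta>" "\<tau> \<in> all_linear_extensions \<Phi> \<Delta> Q \<omega>" "Inv \<sigma> \<subseteq> Inv \<tau>"
  shows "\<sigma> \<in> all_linear_extensions \<Phi> \<Delta> Q \<omega>"
  using assms linear_extension_below unfolding mem_all_linear_extensions by blast

lemma linear_extensions_disjoint:
  assumes "I \<in> facets \<Delta> Q \<omega>" "J \<in> facets \<Delta> Q \<omega>" "I \<noteq> J"
  shows "linear_extensions \<Phi> \<Delta> Q I \<inter> linear_extensions \<Phi> \<Delta> Q J = {}"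
proof (rule ccontr)
  assume "\<not> ?thesis"
  then obtain \<pi> where "\<pi> \<in> linear_extensions \<Phi> \<Delta> Q I" "\<pi> \<in> linear_extensions \<Phi> \<Delta> Q J" by blast
  then have "\<pi> \<in> coxeter_group \<Delta>" "\<forall>i\<in>I. root_at Q I i \<in> \<pi> ` Pos"
    "\<forall>i\<in>J. root_at Q J i \<in> \<pi> ` Pos"
    by (auto simp: linear_extensions_def root_configuration_def)
  then show False using linear_extension_unique assms by blast
qed

end

end

theorem theorem5p11:
  fixes \<Phi> \<Delta> :: "'a::euclidean_space set"
    and Q :: "('a \<Rightarrow> 'a) list"
    and \<omega> :: "'a \<Rightarrow> 'a"
  assumes "root_system \<Phi>"
    and "simple_system \<Phi> \<Delta>"
    and "set Q \<subseteq> simple_reflections \<Delta>"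
    and "\<omega> \<in> coxeter_group \<Delta>"
    and "subword_complex \<Delta> Q \<omega> \<noteq> {}"
  shows "(\<forall>I\<in>facets \<Delta> Q \<omega>. order_convex \<Phi> \<Delta> (linear_extensions \<Phi> \<Delta> Q I)) \<and>
    lower_set \<Phi> \<Delta> (all_linear_extensions \<Phi> \<Delta> Q \<omega>) \<and>
    weak_interval_from_id \<Phi> \<Delta> \<omega> \<subseteq> all_linear_extensions \<Phi> \<Delta> Q \<omega> \<and>
    (\<forall>I\<^sub>1\<in>facets \<Delta> Q \<omega>. \<forall>I\<^sub>2\<in>facets \<Delta> Q \<omega>. I\<^sub>1 \<noteq> I\<^sub>2 \<longrightarrow>
       linear_extensions \<Phi> \<Delta> Q I\<^sub>1 \<inter> linear_extensions \<Phi> \<Delta> Q I\<^sub>2 = {})"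
proof -
  interpret simple_roots \<Phi> \<Delta>
    using assms(1,2) by unfold_locales
  have "facets \<Delta> Q \<omega> \<noteq> {}" using assms(5) by (auto simp: subword_complex_def)
  \<comment> \<open>Once \<omega> itself is in the union, downward closure yields the whole interval
    below it.\<close>
  then have top: "\<omega> \<in> all_linear_extensions \<Phi> \<Delta> Q \<omega>"
    using linear_extension_top[OF assms(3) root_automorphism_coxeter[OF assms(4)]] assms(4)
    by (simp add: mem_all_linear_extensions[OF assms(3)])
  have lower: "\<sigma> \<in> all_linear_extensions \<Phi> \<Delta> Q \<omega>"
    if "\<sigma> \<in> coxeter_group \<Delta>" "\<tau> \<in> all_linear_extensions \<Phi> \<Delta> Q \<omega>" "weak_le \<Phi> \<Delta> \<sigma> \<tau>" for \<sigma> \<tau>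
    using all_linear_extensions_lower[OF assms(3)] that by (simp add: weak_le_def)
  have "lower_set \<Phi> \<Delta> (all_linear_extensions \<Phi> \<Delta> Q \<omega>)"
    using lower unfolding lower_set_def weak_less_def
    by (auto simp: all_linear_extensions_def linear_extensions_def)
  moreover have "weak_interval_from_id \<Phi> \<Delta> \<omega> \<subseteq> all_linear_extensions \<Phi> \<Delta> Q \<omega>"
    using lower top by (auto simp: weak_interval_from_id_def)
  ultimately show ?thesis
    using linear_extensions_order_convex[OF assms(3)] linear_extensions_disjoint[OF assms(3)]
    by blast
qed

end
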